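(* Let $q\in\mathbb{C}$ with $|q|<1$. Then $$\sum_{n=0}^\infty \frac{q^{n(n+1)}(-q^3;q^3)_{n}}{(-q;q)_n(q;q)_{2n+1}} = \frac{(q^3;q^3)_\infty(q^3;q^{18})_\infty(q^{15};q^{18})_\infty}{(q;q)_\infty}.$$
   Context: For $|q|<1$, $x\in\mathbb{C}$ and an integer $n\ge 0$: $(x;q)_n=\prod_{j=0}^{n-1}(1-xq^j)$ (so $(x;q)_0=1$) and $(x;q)_\infty=\prod_{j=0}^{\infty}(1-xq^j)$. The same notation is used with base $q^m$ in place of $q$. *)

theory Defs
  imports "HOL-Analysis.Analysis"
begin

definition qpoch :: "complex \<Rightarrow> complex \<Rightarrow> nat \<Rightarrow> complex" where
  "qpoch x q n = (\<Prod>j<n. 1 - x * q ^ j)"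

definition qpoch_inf :: "complex \<Rightarrow> complex \<Rightarrow> complex" where
  "qpoch_inf x q = (\<Prod>j. 1 - x * q ^ j)"

text \<open>
  For base of modulus less than 1 the infinite product converges for every \<open>x\<close>
  (also when some factor vanishes), so \<open>qpoch_inf\<close> is its genuine value.
\<close>

lemma qpoch_inf_has_prod:
  fixes x q :: complex
  assumes "norm q < 1"
  shows "(\<lambda>j. 1 - x * q ^ j) has_prod qpoch_inf x q"
proof -
  have "summable (\<lambda>j. norm q ^ j)"
    using assms by (intro summable_geometric) simp
  then have "summable (\<lambda>j. norm x * norm q ^ j)"
    by (rule summable_mult)
  then have "summable (\<lambda>j. norm ((1 - x * q ^ j) - 1))"
    using assms by (simp add: norm_mult norm_power)
  then have "convergent_prod (\<lambda>j. 1 - x * q ^ j)"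
    by (intro abs_convergent_prod_imp_convergent_prod summable_imp_abs_convergent_prod)
  then show ?thesis
    unfolding qpoch_inf_def by (rule convergent_prod_has_prod)
qed

end

theory Submission
  imports Defs
begin

text \<open>
  Since $1 + x^3 = (1 + x)(1 - x + x^2)$, the $n$-th summand is $q^{n(n+1)} \beta_n$ with
  $\beta_n = \prod_{k=1}^n (1 - t q^k + q^{2k}) / (q;q)_{2n+1}$ and $t = 1$. For every $t$,
  $\beta_n = \sum_{j \le n} \alpha_j / ((q;q)_{n-j} (q;q)_{n+j+1})$, where
  $\alpha_j = (-1)^j \chi_j q^{j(j+1)/2}$ and $\chi_j = \sum_{i=-j}^{j} z^i$ if $t = z + 1/z$.
  Summing over $n$ first, by the Durfee rectangle identity, turns the series into
  $\sum_j (-1)^j \chi_j q^{3j(j+1)/2} / (q;q)_\infty$. Letting $n \to \infty$ in the expansion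
  of $\beta_n$, with $q^3$ in place of $q$, evaluates this theta series as a product (this is the
  Jacobi triple product), and for $t = 1$ that product collapses to base $q^{18}$.
\<close>

section \<open>Finite and infinite q-products: limits and non-vanishing\<close>

lemma qpoch_Suc: "qpoch x q (Suc n) = qpoch x q n * (1 - x * q ^ n)"
  by (simp add: qpoch_def)

lemma qpoch_0 [simp]: "qpoch x q 0 = 1"
  by (simp add: qpoch_def)

lemma qpoch_tendsto:
  assumes "norm q < 1"
  shows "qpoch x q \<longlonglongrightarrow> qpoch_inf x q"
  unfolding qpoch_def by (rule has_prod_imp_tendsto'[OF qpoch_inf_has_prod[OF assms]])

lemma norm_power_Suc_less_one:
  fixes q :: "'a :: real_normed_div_algebra"
  assumes "norm q < 1"
  shows "norm (q ^ Suc n) < 1"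
  using assms power_Suc_less_one[of "norm q" n]
  by (cases "q = 0") (auto simp: norm_power norm_mult)

lemma one_minus_power_Suc_nonzero:
  fixes q :: "'a :: real_normed_div_algebra"
  assumes "norm q < 1"
  shows "1 - q * q ^ n \<noteq> 0"
proof
  assume "1 - q * q ^ n = 0"
  then have "norm (q ^ Suc n) = 1" by simp
  then show False using norm_power_Suc_less_one[OF assms, of n] by simp
qed

lemma qpoch_nonzero:
  assumes "norm q < 1"
  shows "qpoch q q n \<noteq> 0"
  using one_minus_power_Suc_nonzero[OF assms] by (simp add: qpoch_def)

text \<open>A product convergent in the sense of \<open>has_prod\<close> vanishes only if one of its
  factors does.\<close>

lemma qpoch_inf_nonzero:
  assumes "norm q < 1"
  shows "qpoch_inf q q \<noteq> 0"
  using has_prod_eq_0_iff[OF qpoch_inf_has_prod[OF assms, of q]]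
    one_minus_power_Suc_nonzero[OF assms] by fastforce

lemma inverse_qpoch_tendsto:
  assumes "norm q < 1"
  shows "(\<lambda>n. 1 / qpoch q q n) \<longlonglongrightarrow> 1 / qpoch_inf q q"
  by (intro tendsto_intros qpoch_tendsto qpoch_inf_nonzero assms)

text \<open>The constant \<open>C\<close> feeds every dominating series in the limit interchanges
  below.\<close>

lemma inverse_qpoch_bounded:
  assumes "norm q < 1"
  obtains C where "C > 0" "\<And>n. norm (1 / qpoch q q n) \<le> C"
  using convergent_imp_Bseq[OF convergentI[OF inverse_qpoch_tendsto[OF assms]]]
  by (auto elim!: BseqE)

section \<open>The finite expansion of \<open>triprod\<close> in the characters
  \<open>chi\<close>\<close>

text \<open>The character $\chi_j$ of the header as a polynomial in \<open>t\<close>.\<close>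

fun chi :: "complex \<Rightarrow> nat \<Rightarrow> complex" where
  "chi t 0 = 1"
| "chi t (Suc 0) = t + 1"
| "chi t (Suc (Suc j)) = t * chi t (Suc j) - chi t j"

definition tri :: "nat \<Rightarrow> nat" where
  "tri j = j * (j + 1) div 2"

lemma tri_0 [simp]: "tri 0 = 0"
  by (simp add: tri_def)

lemma tri_Suc: "tri (Suc j) = tri j + Suc j"
  by (simp add: tri_def)

lemma two_tri: "2 * tri j = j * (j + 1)"
  by (simp add: tri_def)

lemma le_tri: "j \<le> tri j"
  by (induction j) (auto simp: tri_Suc)

text \<open>Up to a factor 1 - q this is the kernel of Bailey pairs relative to a = q. The value 0
  for j > n encodes 1/(q;q)_m = 0 for negative m, which truncated subtraction would not
  give.\<close>

definition bailey :: "complex \<Rightarrow> nat \<Rightarrow> nat \<Rightarrow> complex" where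
  "bailey q n j = (if j \<le> n then 1 / (qpoch q q (n - j) * qpoch q q (n + j + 1)) else 0)"

text \<open>For t = z + 1/z this is (zq;q)_n (q/z;q)_n.\<close>

definition triprod :: "complex \<Rightarrow> complex \<Rightarrow> nat \<Rightarrow> complex" where
  "triprod t q n = (\<Prod>k<n. 1 - t * q ^ Suc k + (q ^ Suc k)\<^sup>2)"

text \<open>
  Expands $t \chi_j = \chi_{j+1} + \chi_{j-1}$ and sums by parts; the exceptional coefficient
  at \<open>j = 0\<close> comes from $\chi_{-1} = -\chi_0$.
\<close>

lemma sum_chi_shift:
  "(\<Sum>j\<le>M. chi t j * (case j of 0 \<Rightarrow> a 1 - a 0 | Suc i \<Rightarrow> a i + a (Suc (Suc i))))
     = t * (\<Sum>j\<le>M. chi t j * a j) + (chi t M * a (Suc M) - chi t (Suc M) * a M)"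
  by (induction M) (simp_all add: algebra_simps)

text \<open>All neighbours are put over the denominator of \<open>bailey q (Suc n) j\<close>, so
  that a recurrence becomes a polynomial identity. The numerators vanish exactly where the default
  value 0 of \<open>bailey\<close> applies. The factor \<open>q\<close> in the third equation turns
  1 - q^(n-j) into q - q^(n+1-j), which avoids a negative exponent at j = n + 1 and division by
  \<open>q\<close>.\<close>

lemma bailey_raise:
  assumes q: "norm q < 1" and j: "j \<le> Suc n"
  defines "D \<equiv> qpoch q q (Suc n - j) * qpoch q q (n + j + 2)"
  shows "bailey q (Suc n) j = 1 / D"
    and "bailey q n j = (1 - q ^ (Suc n - j)) * (1 - q ^ (n + j + 2)) / D"
    and "q * bailey q n (Suc j) = (1 - q ^ (Suc n - j)) * (q - q ^ (Suc n - j)) / D"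
    and "j = Suc i \<Longrightarrow> bailey q n i = (1 - q ^ (n + j + 1)) * (1 - q ^ (n + j + 2)) / D"
proof -
  note nz = qpoch_nonzero[OF q] one_minus_power_Suc_nonzero[OF q]
  have up: "qpoch q q (Suc m) = qpoch q q m * (1 - q ^ Suc m)" for m
    by (simp add: qpoch_Suc)
  have nz': "1 - q ^ Suc m \<noteq> 0" for m
    using nz(2)[of m] by simp
  have e: "n + j + 2 = Suc (n + j + 1)" by simp
  show "bailey q (Suc n) j = 1 / D"
    using j by (simp add: bailey_def D_def)
  show "bailey q n j = (1 - q ^ (Suc n - j)) * (1 - q ^ (n + j + 2)) / D"
  proof (cases "j \<le> n")
    case True
    show ?thesis
      unfolding D_def e Suc_diff_le[OF True] up bailey_def
      using True nz(1) nz'[of "n - j"] nz'[of "n + j + 1"] by simp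
  qed (use j in \<open>simp add: bailey_def le_Suc_eq\<close>)
  show "q * bailey q n (Suc j) = (1 - q ^ (Suc n - j)) * (q - q ^ (Suc n - j)) / D"
  proof (cases "j < n")
    case True
    then obtain m where m: "n = Suc (j + m)"
      using less_iff_Suc_add by auto
    have d: "Suc n - j = Suc (Suc m)" "n - Suc j = m" "q - q ^ Suc (Suc m) = q * (1 - q ^ Suc m)"
      by (simp_all add: m algebra_simps)
    show ?thesis
      unfolding D_def bailey_def d(1) up d(3)
      using True nz(1)[of m] nz'[of m] nz'[of "Suc m"] by (simp add: d(2))
  next
    case False
    with j consider "j = n" | "j = Suc n" by linarith
    then show ?thesis by cases (simp_all add: bailey_def)
  qed
  show "bailey q n i = (1 - q ^ (n + j + 1)) * (1 - q ^ (n + j + 2)) / D" if "j = Suc i"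
  proof -
    have d: "Suc n - j = n - i" "n + j = Suc (n + i)" "i \<le> n" using that j by auto
    have f: "n + j + 2 = Suc (Suc (Suc (n + i)))" "n + j + 1 = Suc (Suc (n + i))" using d by auto
    show ?thesis
      unfolding D_def bailey_def f up d(1)
      using nz(1) nz'[of "Suc (n+i)"] nz'[of "Suc (Suc (n+i))"] d(3) by (simp add: up)
  qed
qed

text \<open>With X = q^(n+1), the left factor consists of the two new factors of (q;q)_(2n+3), and
  the right side is the coefficient of chi_j after multiplying the expansion for n by 1 - tX +
  X^2.\<close>

lemma bailey_step:
  fixes n j q
  defines "a \<equiv> \<lambda>n j. (-1) ^ j * q ^ tri j * bailey q n j"
  assumes q: "norm q < 1"
  shows "(1 - (q ^ Suc n)\<^sup>2) * (1 - (q ^ Suc n)\<^sup>2 * q) * a (Suc n) j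
         = (1 + (q ^ Suc n)\<^sup>2) * a n j
           - q ^ Suc n * (case j of 0 \<Rightarrow> a n 1 - a n 0 | Suc i \<Rightarrow> a n i + a n (Suc (Suc i)))"
proof (cases "j \<le> Suc n")
  case False
  then show ?thesis
    by (auto simp: a_def bailey_def split: nat.split)
next
  case True
  \<comment> \<open>In \<open>u\<close>, \<open>y\<close> and \<open>q\<close> all numerators of
    \<open>bailey_raise\<close> are polynomials, since \<open>q ^ Suc n = u * y\<close>.\<close>
  define u y D where "u = q ^ (Suc n - j)" and "y = q ^ j"
    and "D = qpoch q q (Suc n - j) * qpoch q q (n + j + 2)"
  have X: "q ^ Suc n = u * y"
    unfolding u_def y_def using True by (metis le_add_diff_inverse2 power_add)
  have Xy: "q ^ (n + j + 1) = u * y * y" "q ^ (n + j + 2) = u * y * y * q"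
    using X by (simp_all add: y_def power_add algebra_simps)
  note raise = bailey_raise[OF q True, folded u_def D_def, unfolded Xy]
  have D: "D \<noteq> 0"
    using qpoch_nonzero[OF q] by (simp add: D_def)
  show ?thesis
  proof (cases j)
    case 0
    have y: "y = 1" by (simp add: y_def 0)
    have "(1 - u\<^sup>2) * (1 - u\<^sup>2 * q) * (1 / D)
         = (1 + u\<^sup>2) * ((1 - u) * (1 - u * q) / D)
           - u * (- ((1 - u) * (q - u) / D) - (1 - u) * (1 - u * q) / D)"
      using D by (simp add: divide_simps) algebra
    then show ?thesis
      using raise(1-3) unfolding X by (simp add: a_def 0 y tri_Suc)
  next
    case (Suc i)
    have y: "q * q ^ i = y" by (simp add: y_def Suc)
    \<comment> \<open>The step from j to j + 1 contributes \<open>y * q\<close> to the power of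
      \<open>q\<close>; this spare \<open>q\<close> is the one required by the third equation of
      \<open>bailey_raise\<close>.\<close>
    have tri_Suc': "q ^ tri (Suc i) = q ^ tri i * y" 
      "q ^ tri (Suc (Suc i)) * bailey q n (Suc j) = q ^ tri i * y * y * (q * bailey q n (Suc j))"
      by (simp_all add: tri_Suc power_add y[symmetric])
    \<comment> \<open>The recurrence with the common factor \<open>(-1) ^ i * q ^ tri i\<close>
      removed, where i = j - 1.\<close>
    have "(1 - (u * y)\<^sup>2) * (1 - (u * y)\<^sup>2 * q) * (- y * (1 / D))
         = (1 + (u * y)\<^sup>2) * (- y * ((1 - u) * (1 - u * y * y * q) / D))
           - u * y * ((1 - u * y * y) * (1 - u * y * y * q) / D + y * y * ((1 - u) * (q - u) / D))"
      using D by (simp add: divide_simps) algebra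
    then have "(-1) ^ i * q ^ tri i * ((1 - (u * y)\<^sup>2) * (1 - (u * y)\<^sup>2 * q) * (- y * (1 / D)))
         = (-1) ^ i * q ^ tri i * ((1 + (u * y)\<^sup>2) * (- y * ((1 - u) * (1 - u * y * y * q) / D))
           - u * y * ((1 - u * y * y) * (1 - u * y * y * q) / D + y * y * ((1 - u) * (q - u) / D)))"
      by (rule arg_cong)
    moreover have "a (Suc n) j = (-1) ^ i * q ^ tri i * (- y * (1 / D))"
      unfolding a_def raise(1) unfolding Suc tri_Suc' by simp
    moreover have "a n j = (-1) ^ i * q ^ tri i * (- y * ((1 - u) * (1 - u * y * y * q) / D))"
      unfolding a_def raise(2) unfolding Suc tri_Suc' by simp
    moreover have "a n i = (-1) ^ i * q ^ tri i * ((1 - u * y * y) * (1 - u * y * y * q) / D)"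
      unfolding a_def raise(4)[OF Suc] ..
    moreover have "a n (Suc (Suc i)) = (-1) ^ i * q ^ tri i * (y * y * ((1 - u) * (q - u) / D))"
      using tri_Suc'(2) unfolding a_def Suc[symmetric] raise(3) by (simp add: Suc mult.assoc)
    ultimately show ?thesis
      unfolding X Suc nat.case by (simp only: algebra_simps)
  qed
qed

text \<open>Induction on n: \<open>bailey_step\<close> lowers n in the coefficients, and
  \<open>sum_chi_shift\<close> recombines the neighbours into multiplication by the new factor of
  \<open>triprod\<close>.\<close>

lemma triprod_expansion:
  assumes q: "norm q < 1"
  shows "triprod t q n / qpoch q q (2 * n + 1)
         = (\<Sum>j\<le>n. chi t j * ((-1) ^ j * q ^ tri j * bailey q n j))"
proof (induction n)
  case 0
  show ?case by (simp add: triprod_def bailey_def)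
next
  case (Suc n)
  define a where "a = (\<lambda>n j. (-1) ^ j * q ^ tri j * bailey q n j)"
  define X where "X = q ^ Suc n"
  have "X\<^sup>2 = q ^ (2 * n + 2)" "X\<^sup>2 * q = q ^ (2 * n + 3)"
    by (simp_all add: X_def power_mult[symmetric] power_add[symmetric] power2_eq_square
        mult_2 numeral_3_eq_3)
  then have q1: "qpoch q q (2 * Suc n + 1) = qpoch q q (2 * n + 1) * ((1 - X\<^sup>2) * (1 - X\<^sup>2 * q))"
    by (simp add: qpoch_Suc numeral_3_eq_3)
  have nz: "(1 - X\<^sup>2) * (1 - X\<^sup>2 * q) \<noteq> 0"
    using qpoch_nonzero[OF q, of "2 * Suc n + 1"] unfolding q1 by simp
  \<comment> \<open>These values kill the boundary terms of \<open>sum_chi_shift\<close> at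
    \<open>M = Suc n\<close> and the last term of the sum.\<close>
  have zero: "a n (Suc n) = 0" "a n (Suc (Suc n)) = 0"
    by (simp_all add: a_def bailey_def)
  let ?s = "\<lambda>j. case j of 0 \<Rightarrow> a n 1 - a n 0 | Suc i \<Rightarrow> a n i + a n (Suc (Suc i))"
  have "(1 - X\<^sup>2) * (1 - X\<^sup>2 * q) * (\<Sum>j\<le>Suc n. chi t j * a (Suc n) j)
      = (\<Sum>j\<le>Suc n. chi t j * ((1 - X\<^sup>2) * (1 - X\<^sup>2 * q) * a (Suc n) j))"
    unfolding sum_distrib_left by (intro sum.cong) (simp_all add: mult_ac)
  also have "\<dots> = (\<Sum>j\<le>Suc n. chi t j * ((1 + X\<^sup>2) * a n j - X * ?s j))"
    unfolding a_def X_def bailey_step[OF q] ..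
  also have "\<dots> = (1 + X\<^sup>2) * (\<Sum>j\<le>Suc n. chi t j * a n j) - X * (\<Sum>j\<le>Suc n. chi t j * ?s j)"
    unfolding sum_distrib_left sum_subtractf[symmetric]
    by (intro sum.cong) (simp_all add: algebra_simps)
  also have "\<dots> = (1 - t * X + X\<^sup>2) * (\<Sum>j\<le>n. chi t j * a n j)"
    unfolding sum_chi_shift by (simp add: zero algebra_simps)
  also have "\<dots> = (1 - t * X + X\<^sup>2) * (triprod t q n / qpoch q q (2 * n + 1))"
    unfolding Suc.IH a_def ..
  also have "\<dots> = triprod t q (Suc n) / qpoch q q (2 * n + 1)"
    by (simp add: triprod_def X_def mult_ac)
  finally have "(\<Sum>j\<le>Suc n. chi t j * a (Suc n) j)
      = triprod t q (Suc n) / qpoch q q (2 * n + 1) / ((1 - X\<^sup>2) * (1 - X\<^sup>2 * q))"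
    using nz by (metis nonzero_mult_div_cancel_left)
  then show ?case
    unfolding q1 a_def divide_divide_eq_left by (rule sym)
qed

section \<open>The Durfee rectangle identity\<close>

text \<open>The bound is uniform in \<open>a\<close>; it gives summability, boundedness of the sums
  and domination as \<open>a\<close> grows.\<close>

lemma durfee_term_bound:
  assumes "norm q < 1" "\<And>n. norm (1 / qpoch q q n) \<le> C"
  shows "norm (q ^ (m\<^sup>2 + a * m) / (qpoch q q m * qpoch q q (m + a))) \<le> norm q ^ m * C\<^sup>2"
proof -
  have C: "C \<ge> 0" using norm_ge_zero assms(2) by (rule order_trans)
  have "norm q ^ (m\<^sup>2 + a * m) \<le> norm q ^ m"
    using assms(1) by (intro power_decreasing) (auto simp: power2_eq_square intro: trans_le_add1)
  then have "norm q ^ (m\<^sup>2 + a * m) * (norm (1 / qpoch q q m) * norm (1 / qpoch q q (m + a)))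
      \<le> norm q ^ m * (C * C)"
    using assms(2) C by (intro mult_mono) auto
  then show ?thesis
    by (simp add: norm_divide norm_mult norm_power power2_eq_square)
qed

text \<open>
  The sum \<open>F a\<close> satisfies $F_a - F_{a+1} = -q^{a+1} (F_{a+1} - F_{a+2})$, and it is bounded, so it
  does not depend on \<open>a\<close>; the value is found by letting \<open>a\<close> tend to infinity.
\<close>

lemma durfee:
  assumes q: "norm q < 1"
  shows "(\<lambda>m. q ^ (m\<^sup>2 + a * m) / (qpoch q q m * qpoch q q (m + a))) sums (1 / qpoch_inf q q)"
proof -
  note nz = qpoch_nonzero[OF q]
  obtain C where C: "C > 0" "\<And>n. norm (1 / qpoch q q n) \<le> C"
    using inverse_qpoch_bounded[OF q] by blast
  define f where "f = (\<lambda>m a. q ^ (m\<^sup>2 + a * m) / (qpoch q q m * qpoch q q (m + a)))"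
  define F where "F = (\<lambda>a. \<Sum>m. f m a)"
  have bound: "norm (f m a) \<le> norm q ^ m * C\<^sup>2" for m a
    unfolding f_def by (rule durfee_term_bound[OF q C(2)])
  have sumM: "summable (\<lambda>m. norm q ^ m * C\<^sup>2)"
    using q by (intro summable_mult2 summable_geometric) simp
  have sumf: "summable (\<lambda>m. f m a)" for a
    by (rule summable_comparison_test'[OF sumM, of 0]) (rule bound)
  have normF: "norm (F a) \<le> (\<Sum>m. norm q ^ m * C\<^sup>2)" (is "_ \<le> ?K") for a
    unfolding F_def by (intro norm_suminf_le sumM bound)
  have rec: "F a - F (Suc a) = q ^ Suc a * (F (Suc (Suc a)) - F (Suc a))" for a
  proof -
    \<comment> \<open>The factor \<open>1 - q ^ m\<close> removes the term m = 0 and cancels the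
      last factor of (q;q)_m, so shifting m by one turns \<open>g\<close> into a multiple of the
      summand for a + 2.\<close>
    define g where "g = (\<lambda>m. q ^ (m\<^sup>2 + a * m) * (1 - q ^ m) / (qpoch q q m * qpoch q q (m + Suc a)))"
    have split: "f m a - f m (Suc a) = g m - q ^ Suc a * f m (Suc a)" for m
    proof -
      have "qpoch q q (m + Suc a) = qpoch q q (m + a) * (1 - q ^ Suc a * q ^ m)"
        by (simp add: qpoch_Suc power_add mult_ac)
      moreover have "q ^ (m\<^sup>2 + Suc a * m) = q ^ (m\<^sup>2 + a * m) * q ^ m"
        by (simp add: power_add algebra_simps)
      ultimately show ?thesis
        using nz[of m] nz[of "m + a"] nz[of "m + Suc a"]
        by (simp add: f_def g_def divide_simps) (simp add: algebra_simps)
    qed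
    have g0: "g 0 = 0" by (simp add: g_def)
    have gS: "g (Suc m) = q ^ Suc a * f m (Suc (Suc a))" for m
    proof -
      have "qpoch q q (Suc m) = qpoch q q m * (1 - q ^ Suc m)"
        by (simp add: qpoch_Suc)
      moreover have "q ^ ((Suc m)\<^sup>2 + a * Suc m) = q ^ Suc a * q ^ (m\<^sup>2 + Suc (Suc a) * m)"
        by (simp add: power_add[symmetric] power2_eq_square algebra_simps del: power_Suc)
      ultimately show ?thesis
        using nz[of "Suc m"] nz[of m] nz[of "Suc m + Suc a"] by (simp add: f_def g_def)
    qed
    have "(\<lambda>m. g (Suc m)) sums (q ^ Suc a * F (Suc (Suc a)))"
      unfolding gS F_def by (intro sums_mult summable_sums sumf)
    then have "g sums (q ^ Suc a * F (Suc (Suc a)))"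
      using sums_Suc[of g] g0 by simp
    then have "(\<lambda>m. g m - q ^ Suc a * f m (Suc a)) sums
        (q ^ Suc a * F (Suc (Suc a)) - q ^ Suc a * F (Suc a))"
      unfolding F_def by (intro sums_diff sums_mult summable_sums sumf)
    moreover have "(\<lambda>m. f m a - f m (Suc a)) sums (F a - F (Suc a))"
      unfolding F_def by (intro sums_diff summable_sums sumf)
    ultimately show ?thesis
      unfolding split by (simp add: sums_unique2 right_diff_distrib)
  qed
  have step: "norm (F a - F (Suc a)) \<le> norm q * norm (F (Suc a) - F (Suc (Suc a)))" for a
  proof -
    have "norm (F a - F (Suc a)) = norm q ^ Suc a * norm (F (Suc a) - F (Suc (Suc a)))"
      unfolding rec[of a] norm_mult norm_power 
        norm_minus_commute[of "F (Suc (Suc a))" "F (Suc a)"] ..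
    also have "\<dots> \<le> norm q ^ 1 * norm (F (Suc a) - F (Suc (Suc a)))"
      using q by (intro mult_right_mono power_decreasing) auto
    finally show ?thesis by simp
  qed
  have iter: "norm (F a - F (Suc a)) \<le> norm q ^ k * norm (F (a + k) - F (Suc (a + k)))" for a k
  proof (induction k)
    case (Suc k)
    have "norm q ^ k * norm (F (a + k) - F (Suc (a + k)))
        \<le> norm q ^ k * (norm q * norm (F (a + Suc k) - F (Suc (a + Suc k))))"
      using step[of "a + k"] by (intro mult_left_mono) auto
    with Suc.IH show ?case by (simp add: mult_ac)
  qed simp
  have const: "F a = F (Suc a)" for a
  proof -
    have "norm (F a - F (Suc a)) \<le> norm q ^ k * (2 * ?K)" for k
    proof -
      have "norm (F (a + k) - F (Suc (a + k))) \<le> 2 * ?K"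
        using norm_triangle_ineq4[of "F (a + k)" "F (Suc (a + k))"] normF[of "a + k"]
          normF[of "Suc (a + k)"] by linarith
      then show ?thesis
        using iter[of a k] by (meson mult_left_mono norm_ge_zero order_trans zero_le_power)
    qed
    moreover have lim0: "(\<lambda>k. norm q ^ k * (2 * ?K)) \<longlonglongrightarrow> 0"
      using q by (intro tendsto_mult_left_zero LIMSEQ_power_zero) simp
    ultimately have "norm (F a - F (Suc a)) \<le> 0"
      by (intro LIMSEQ_le_const[OF lim0]) blast
    then show ?thesis by simp
  qed
  have F0: "F a = F 0" for a
    by (induction a) (simp_all add: const[symmetric])
  \<comment> \<open>The termwise limit as \<open>a\<close> tends to infinity: for m > 0 the exponent
    is at least \<open>a\<close>, so only m = 0 survives.\<close>
  define b where "b = (\<lambda>m::nat. if m = 0 then 1 / qpoch_inf q q else 0)"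
  have lim: "(\<lambda>a. f m a) \<longlonglongrightarrow> b m" for m
  proof (cases m)
    case 0
    then show ?thesis
      using inverse_qpoch_tendsto[OF q] by (simp add: f_def b_def)
  next
    case (Suc i)
    have "norm (f m a) \<le> norm q ^ a * C\<^sup>2" for a
    proof -
      have "norm q ^ (m\<^sup>2 + a * m) \<le> norm q ^ a"
        using q by (intro power_decreasing) (simp_all add: Suc trans_le_add2)
      then have "norm q ^ (m\<^sup>2 + a * m) * (norm (1 / qpoch q q m) * norm (1 / qpoch q q (m + a)))
          \<le> norm q ^ a * (C * C)"
        using C by (intro mult_mono) auto
      then show ?thesis
        by (simp add: f_def norm_divide norm_mult norm_power power2_eq_square)
    qed
    moreover have "(\<lambda>a. norm q ^ a * C\<^sup>2) \<longlonglongrightarrow> 0"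
      using q by (intro tendsto_mult_left_zero LIMSEQ_power_zero) simp
    ultimately have "(\<lambda>a. f m a) \<longlonglongrightarrow> 0"
      by (rule Lim_null_comparison[OF always_eventually[OF allI]])
    then show ?thesis by (simp add: b_def Suc)
  qed
  have "F \<longlonglongrightarrow> suminf b"
    unfolding F_def
  proof (rule tannerys_theorem[THEN conjunct2, THEN conjunct2, OF lim])
    show "\<forall>\<^sub>F (m, a) in at_top \<times>\<^sub>F at_top. norm (f m a) \<le> norm q ^ m * C\<^sup>2"
      using bound by (intro always_eventually) auto
  qed (rule sumM, simp)
  moreover have "suminf b = 1 / qpoch_inf q q"
    using sums_unique[OF sums_single[of 0 "\<lambda>_. 1 / qpoch_inf q q"]] by (simp add: b_def)
  moreover have "F \<longlonglongrightarrow> F 0"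
    by (rule tendsto_eventually, rule always_eventually, rule allI, rule F0)
  ultimately have "F 0 = 1 / qpoch_inf q q"
    by (auto dest: LIMSEQ_unique)
  then show ?thesis
    using summable_sums[OF sumf[of a]] F0[of a] by (simp add: F_def f_def)
qed

section \<open>Limits and sums of the kernel, the theta series and the interchange of
  summations\<close>

lemma bailey_bound:
  assumes "\<And>n. norm (1 / qpoch q q n) \<le> C"
  shows "norm (bailey q n j) \<le> C\<^sup>2"
proof -
  have C: "C \<ge> 0" using norm_ge_zero assms by (rule order_trans)
  have "norm (1 / qpoch q q (n - j)) * norm (1 / qpoch q q (n + j + 1)) \<le> C * C"
    using assms C by (intro mult_mono) auto
  then show ?thesis
    using C by (auto simp: bailey_def norm_divide norm_mult power2_eq_square)
qed

lemma bailey_tendsto: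
  assumes q: "norm q < 1"
  shows "(\<lambda>n. bailey q n j) \<longlonglongrightarrow> 1 / (qpoch_inf q q)\<^sup>2"
proof -
  have "(\<lambda>n. 1 / qpoch q q n * (1 / qpoch q q (n + (2 * j + 1)))) \<longlonglongrightarrow>
      1 / qpoch_inf q q * (1 / qpoch_inf q q)"
    by (intro tendsto_mult inverse_qpoch_tendsto[OF q] LIMSEQ_ignore_initial_segment)
  moreover have "bailey q (n + j) j = 1 / qpoch q q n * (1 / qpoch q q (n + (2 * j + 1)))" for n
  proof -
    have "n + j + j + 1 = n + (2 * j + 1)" by simp
    then show ?thesis by (simp only: bailey_def) simp
  qed
  ultimately have "(\<lambda>n. bailey q (n + j) j) \<longlonglongrightarrow> 1 / (qpoch_inf q q)\<^sup>2"
    by (simp add: power2_eq_square)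
  then show ?thesis
    by (rule LIMSEQ_offset)
qed

text \<open>Terms with n < j vanish. Putting n = m + j splits n(n+1) into j(j+1) + m^2 + (2j+1)m, so
  \<open>durfee\<close> applies with a = 2j + 1.\<close>

lemma bailey_sums:
  assumes q: "norm q < 1"
  shows "(\<lambda>n. q ^ (n * (n + 1)) * bailey q n j) sums (q ^ (j * (j + 1)) / qpoch_inf q q)"
proof -
  have e: "q ^ (j * (j + 1)) * (q ^ (m\<^sup>2 + (2 * j + 1) * m) / (qpoch q q m * qpoch q q (m + (2 * j + 1))))
      = q ^ ((m + j) * (m + j + 1)) * bailey q (m + j) j" for m
  proof -
    have exponent: "j * (j + 1) + (m\<^sup>2 + (2 * j + 1) * m) = (m + j) * (m + j + 1)"
      by (simp add: power2_eq_square algebra_simps)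
    have "m + (2 * j + 1) = m + j + j + 1" by simp
    then have "bailey q (m + j) j = 1 / (qpoch q q m * qpoch q q (m + (2 * j + 1)))"
      unfolding bailey_def by (simp only:) simp
    then show ?thesis
      unfolding times_divide_eq_right power_add[symmetric] exponent by (simp only: mult_1_right times_divide_eq_right)
  qed
  have "(\<lambda>m. q ^ ((m + j) * (m + j + 1)) * bailey q (m + j) j) sums
      (q ^ (j * (j + 1)) * (1 / qpoch_inf q q))"
    using sums_mult[OF durfee[OF q, of "2 * j + 1"], of "q ^ (j * (j + 1))"] unfolding e .
  then show ?thesis
    by (subst (asm) sums_zero_iff_shift) (auto simp: bailey_def)
qed

lemma theta_term_bound:
  assumes "norm q < 1" "norm (chi t j) \<le> B"
  shows "norm (chi t j * ((-1) ^ j * q ^ tri j)) \<le> B * norm q ^ j"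
proof -
  have "norm q ^ tri j \<le> norm q ^ j"
    using assms(1) le_tri by (intro power_decreasing) auto
  then show ?thesis
    using assms(2) by (auto simp: norm_mult norm_power intro!: mult_mono intro: order_trans[OF norm_ge_zero])
qed

text \<open>As n grows in \<open>triprod_expansion\<close>, the kernel tends to
  1/(q;q)_\<infinity>^2 and the left side to L/(q;q)_\<infinity>. Tannery's theorem applies because
  \<open>chi\<close> is bounded and j \<le> \<open>tri j\<close>.\<close>

lemma theta_sums:
  assumes q: "norm q < 1" and B: "\<And>j. norm (chi t j) \<le> B"
    and L: "triprod t q \<longlonglongrightarrow> L"
  shows "(\<lambda>j. chi t j * ((-1) ^ j * q ^ tri j)) sums (qpoch_inf q q * L)"
proof -
  obtain C where C: "\<And>n. norm (1 / qpoch q q n) \<le> C"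
    using inverse_qpoch_bounded[OF q] by blast
  define b where "b = (\<lambda>j. chi t j * ((-1) ^ j * q ^ tri j))"
  have summable_geom: "summable (\<lambda>j. B * norm q ^ j)"
    using q by (intro summable_mult summable_geometric) simp
  have b: "summable b"
    unfolding b_def
    by (rule summable_comparison_test'[OF summable_geom, of 0]) (rule theta_term_bound[OF q B])
  have "(\<lambda>n. \<Sum>j. b j * bailey q n j) \<longlonglongrightarrow> (\<Sum>j. b j * (1 / (qpoch_inf q q)\<^sup>2))"
  proof (rule tannerys_theorem[THEN conjunct2, THEN conjunct2])
    show "(\<lambda>n. b j * bailey q n j) \<longlonglongrightarrow> b j * (1 / (qpoch_inf q q)\<^sup>2)" for j
      by (intro tendsto_intros bailey_tendsto q)
    have "norm (b j * bailey q n j) \<le> B * norm q ^ j * C\<^sup>2" for j n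
      unfolding norm_mult[of "b j"] using theta_term_bound[OF q B] bailey_bound[OF C]
      by (intro mult_mono) (auto simp: b_def intro: order_trans[OF norm_ge_zero])
    then show "\<forall>\<^sub>F (j, n) in at_top \<times>\<^sub>F at_top. norm (b j * bailey q n j) \<le> B * norm q ^ j * C\<^sup>2"
      by (intro always_eventually) auto
  qed (auto intro: summable_mult2 summable_geom)
  moreover have "(\<Sum>j. b j * bailey q n j) = triprod t q n / qpoch q q (2 * n + 1)" for n
    unfolding triprod_expansion[OF q]
    by (subst suminf_finite[of "{..n}"]) (auto simp: bailey_def b_def intro!: sum.cong)
  ultimately have "(\<lambda>n. triprod t q n / qpoch q q (2 * n + 1)) \<longlonglongrightarrow>
      (\<Sum>j. b j) / (qpoch_inf q q)\<^sup>2"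
    using suminf_mult2[OF b, of "1 / (qpoch_inf q q)\<^sup>2"] by simp
  moreover have "(\<lambda>n. triprod t q n / qpoch q q (2 * n + 1)) \<longlonglongrightarrow> L / qpoch_inf q q"
    using LIMSEQ_subseq_LIMSEQ[OF qpoch_tendsto[OF q, of q], of "\<lambda>n. 2 * n + 1"]
    by (intro tendsto_divide L qpoch_inf_nonzero q) (simp add: strict_mono_def o_def)
  ultimately have "(\<Sum>j. b j) / (qpoch_inf q q)\<^sup>2 = L / qpoch_inf q q"
    by (rule LIMSEQ_unique)
  then have "(\<Sum>j. b j) = qpoch_inf q q * L"
    using qpoch_inf_nonzero[OF q] by (simp add: field_simps power2_eq_square)
  then show ?thesis
    using summable_sums[OF b] by (simp add: b_def)
qed

text \<open>Inserting \<open>triprod_expansion\<close> and summing over n first by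
  \<open>bailey_sums\<close> multiplies the j-th term by q^(j(j+1)). As j(j+1) is twice
  \<open>tri j\<close>, the result is the theta series in base q^3, which explains the base in the
  hypothesis on \<open>L\<close>.\<close>

lemma bailey_lemma:
  assumes q: "norm q < 1" and B: "\<And>j. norm (chi t j) \<le> B"
    and L: "triprod t (q ^ 3) \<longlonglongrightarrow> L"
  shows "(\<lambda>n. q ^ (n * (n + 1)) * (triprod t q n / qpoch q q (2 * n + 1))) sums
           (qpoch_inf (q ^ 3) (q ^ 3) * L / qpoch_inf q q)"
proof -
  obtain C where C: "\<And>n. norm (1 / qpoch q q n) \<le> C"
    using inverse_qpoch_bounded[OF q] by blast
  define b where "b = (\<lambda>j. chi t j * ((-1) ^ j * q ^ tri j))"
  \<comment> \<open>The outer sum is cut at \<open>N\<close>; Tannery's theorem in \<open>N\<close>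
    then replaces an exchange of two infinite sums.\<close>
  define f where "f = (\<lambda>j N. b j * (\<Sum>n<N. q ^ (n * (n + 1)) * bailey q n j))"
  let ?G = "\<Sum>n. norm q ^ n"
  have G: "summable (\<lambda>n. norm q ^ n)"
    using q by (intro summable_geometric) simp
  have inner: "norm (\<Sum>n<N. q ^ (n * (n + 1)) * bailey q n j) \<le> ?G * C\<^sup>2" for N j
  proof -
    have "norm (q ^ (n * (n + 1)) * bailey q n j) \<le> norm q ^ n * C\<^sup>2" for n
      unfolding norm_mult norm_power using q bailey_bound[OF C]
      by (intro mult_mono power_decreasing) auto
    then have "norm (\<Sum>n<N. q ^ (n * (n + 1)) * bailey q n j) \<le> (\<Sum>n<N. norm q ^ n * C\<^sup>2)"
      by (rule sum_norm_le)
    also have "\<dots> = (\<Sum>n<N. norm q ^ n) * C\<^sup>2"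
      by (simp add: sum_distrib_right)
    also have "\<dots> \<le> ?G * C\<^sup>2"
      by (intro mult_right_mono sum_le_suminf G) auto
    finally show ?thesis .
  qed
  have lim: "(\<lambda>N. \<Sum>j. f j N) \<longlonglongrightarrow> (\<Sum>j. b j * (q ^ (j * (j + 1)) / qpoch_inf q q))"
  proof (rule tannerys_theorem[THEN conjunct2, THEN conjunct2])
    show "f j \<longlonglongrightarrow> b j * (q ^ (j * (j + 1)) / qpoch_inf q q)" for j
      using bailey_sums[OF q] unfolding f_def sums_def by (intro tendsto_intros)
    have "norm (f j N) \<le> B * norm q ^ j * (?G * C\<^sup>2)" for j N
      unfolding f_def norm_mult[of "b j"] using theta_term_bound[OF q B] inner
      by (intro mult_mono) (auto simp: b_def intro: order_trans[OF norm_ge_zero])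
    then show "\<forall>\<^sub>F (j, N) in at_top \<times>\<^sub>F at_top. norm (f j N) \<le> B * norm q ^ j * (?G * C\<^sup>2)"
      by (intro always_eventually) auto
  qed (rule summable_mult2[OF summable_mult[OF G]], simp)
  \<comment> \<open>For j \<ge> N every kernel value in \<open>f j N\<close> is 0, so both sums are
    finite and can be swapped.\<close>
  have partial: "(\<Sum>j. f j N) = (\<Sum>n<N. q ^ (n * (n + 1)) * (triprod t q n / qpoch q q (2 * n + 1)))" for N
  proof -
    have "(\<Sum>j. f j N) = (\<Sum>j<N. f j N)"
      by (rule suminf_finite) (auto simp: f_def bailey_def)
    also have "\<dots> = (\<Sum>n<N. q ^ (n * (n + 1)) * (\<Sum>j<N. b j * bailey q n j))"
      unfolding f_def sum_distrib_left by (subst sum.swap) (simp add: mult_ac)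
    also have "\<dots> = (\<Sum>n<N. q ^ (n * (n + 1)) * (\<Sum>j\<le>n. b j * bailey q n j))"
      by (intro sum.cong arg_cong2[of _ _ _ _ "(*)"] refl sum.mono_neutral_right)
        (auto simp: bailey_def)
    finally show ?thesis
      unfolding triprod_expansion[OF q] b_def mult.assoc .
  qed
  have "(\<lambda>j. b j * (q ^ (j * (j + 1)) / qpoch_inf q q)) sums
      (qpoch_inf (q ^ 3) (q ^ 3) * L / qpoch_inf q q)"
  proof -
    have "b j * q ^ (j * (j + 1)) = chi t j * ((-1) ^ j * (q ^ 3) ^ tri j)" for j
      unfolding b_def two_tri[symmetric] power_mult[symmetric] mult.assoc power_add[symmetric]
      by simp
    moreover have "norm (q ^ 3) < 1"
      using norm_power_Suc_less_one[OF q, of 2] by (simp add: numeral_3_eq_3)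
    ultimately show ?thesis
      using sums_divide[OF theta_sums[OF _ B L], of "qpoch_inf q q"] by simp
  qed
  from sums_unique[OF this] show ?thesis
    using lim unfolding sums_def partial by simp
qed

section \<open>Product evaluation for t = 1\<close>

text \<open>The factors are cut into n blocks of length m and regrouped by residue modulo m.\<close>

lemma qpoch_split: "qpoch x q (n * m) = (\<Prod>i<m. qpoch (x * q ^ i) (q ^ m) n)"
proof -
  have "qpoch x q (n * m) = (\<Prod>k<n. \<Prod>j\<in>{k * m..<k * m + m}. 1 - x * q ^ j)"
    unfolding qpoch_def by (rule prod.nat_group[symmetric])
  also have "\<dots> = (\<Prod>k<n. \<Prod>i<m. 1 - x * q ^ i * (q ^ m) ^ k)"
  proof (rule prod.cong[OF refl])
    fix k
    have "(\<Prod>j\<in>{k * m..<k * m + m}. 1 - x * q ^ j) = (\<Prod>i\<in>{0..<m}. 1 - x * q ^ (i + k * m))"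
      using prod.shift_bounds_nat_ivl[of "\<lambda>j. 1 - x * q ^ j" 0 "k * m" m] by (simp add: add.commute)
    then show "(\<Prod>j\<in>{k * m..<k * m + m}. 1 - x * q ^ j) = (\<Prod>i<m. 1 - x * q ^ i * (q ^ m) ^ k)"
      by (simp add: atLeast0LessThan power_add power_mult[symmetric] mult_ac)
  qed
  also have "\<dots> = (\<Prod>i<m. qpoch (x * q ^ i) (q ^ m) n)"
    unfolding qpoch_def by (rule prod.swap)
  finally show ?thesis .
qed

lemma qpoch_inf_split:
  assumes q: "norm q < 1" and m: "m > 0"
  shows "qpoch_inf x q = (\<Prod>i<m. qpoch_inf (x * q ^ i) (q ^ m))"
proof -
  have qm: "norm (q ^ m) < 1"
    using norm_power_Suc_less_one[OF q, of "m - 1"] m by simp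
  have "(\<lambda>n. qpoch x q (n * m)) \<longlonglongrightarrow> qpoch_inf x q"
    using LIMSEQ_subseq_LIMSEQ[OF qpoch_tendsto[OF q, of x], of "\<lambda>n. n * m"] m
    by (simp add: strict_mono_def o_def)
  moreover have "(\<lambda>n. qpoch x q (n * m)) \<longlonglongrightarrow> (\<Prod>i<m. qpoch_inf (x * q ^ i) (q ^ m))"
    unfolding qpoch_split by (intro tendsto_prod qpoch_tendsto qm)
  ultimately show ?thesis
    by (rule LIMSEQ_unique)
qed

text \<open>1 - x + x^2 is the sixth cyclotomic polynomial, hence a quotient of factors 1 - x^d with
  d dividing 6. In the limit this is E_6 E_1 / (E_3 E_2) with E_k = (q^k;q^k)_\<infinity>, and
  splitting by residues modulo 6 leaves only the classes 1 and 5.\<close>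

lemma triprod_one_tendsto:
  assumes q: "norm q < 1"
  shows "triprod 1 q \<longlonglongrightarrow> qpoch_inf q (q ^ 6) * qpoch_inf (q ^ 5) (q ^ 6)"
proof -
  have pow: "norm (q ^ 2) < 1" "norm (q ^ 3) < 1" "norm (q ^ 6) < 1"
    using norm_power_Suc_less_one[OF q, of 1] norm_power_Suc_less_one[OF q, of 2]
      norm_power_Suc_less_one[OF q, of 5] by (simp_all add: eval_nat_numeral)
  define E where "E = (\<lambda>k. qpoch_inf (q ^ k) (q ^ k))"
  have E: "E 2 \<noteq> 0" "E 3 \<noteq> 0" "E 6 \<noteq> 0"
    using pow by (simp_all add: E_def qpoch_inf_nonzero)
  define a where "a = (\<lambda>i. qpoch_inf (q ^ i) (q ^ 6))"
  have c: "q ^ m * (q ^ m) ^ i = q ^ (m + m * i)" for m i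
    by (simp add: power_add power_mult)
  have E1: "E 1 = (\<Prod>i<6. a (1 + i))"
    using qpoch_inf_split[OF q, of 6 q] by (simp add: E_def a_def)
  have E2: "E 2 = (\<Prod>i<3. a (2 + 2 * i))"
    using qpoch_inf_split[OF pow(1), of 3 "q ^ 2"] unfolding E_def a_def c by simp
  have E3: "E 3 = (\<Prod>i<2. a (3 + 3 * i))"
    using qpoch_inf_split[OF pow(2), of 2 "q ^ 3"] unfolding E_def a_def c by simp
  have prods: "(\<Prod>i<6. g i) = g 0 * g 1 * g 2 * g 3 * g 4 * g 5"
    "(\<Prod>i<3. g i) = g 0 * g 1 * g 2" "(\<Prod>i<2. g i) = g 0 * g 1" for g :: "nat \<Rightarrow> complex"
    by (simp_all add: eval_nat_numeral)
  have E6: "E 6 = a 6"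
    by (simp add: E_def a_def)
  have split:
    "E 1 = a 1 * a 2 * a 3 * a 4 * a 5 * E 6" "E 2 = a 2 * a 4 * E 6" "E 3 = a 3 * E 6"
    unfolding E1 E2 E3 E6 prods by (simp_all add: eval_nat_numeral)
  have factor: "1 - x + x\<^sup>2 = (1 - x ^ 6) * (1 - x) / ((1 - x ^ 3) * (1 - x ^ 2))"
    if "1 - x ^ 3 \<noteq> 0" "1 - x ^ 2 \<noteq> 0" for x :: complex
    using that by (simp add: divide_simps) algebra
  have eq: "triprod 1 q n = qpoch (q ^ 6) (q ^ 6) n * qpoch (q ^ 1) (q ^ 1) n /
      (qpoch (q ^ 3) (q ^ 3) n * qpoch (q ^ 2) (q ^ 2) n)" for n
  proof -
    have c': "q ^ m * (q ^ m) ^ k = (q ^ Suc k) ^ m" for m k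
      by (simp add: power_mult_distrib power_mult[symmetric] mult.commute)
    have "1 - (q ^ Suc k) ^ 3 \<noteq> 0" "1 - (q ^ Suc k) ^ 2 \<noteq> 0" for k
      using one_minus_power_Suc_nonzero[OF pow(1), of k] one_minus_power_Suc_nonzero[OF pow(2), of k]
      by (simp_all only: c' not_False_eq_True)
    then show ?thesis
      unfolding qpoch_def triprod_def c'
      by (simp add: prod_dividef[symmetric] prod.distrib[symmetric] factor del: power_Suc)
  qed
  have "(\<lambda>n. triprod 1 q n) \<longlonglongrightarrow> E 6 * E 1 / (E 3 * E 2)"
    unfolding eq E_def
    by (intro tendsto_intros qpoch_tendsto) (use q pow E in \<open>simp_all add: E_def\<close>)
  moreover have "E 6 * E 1 / (E 3 * E 2) = a 1 * a 5"
    using E unfolding split by (simp add: field_simps)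
  ultimately show ?thesis
    by (simp add: a_def)
qed

section \<open>Specialisation to t = 1 and conclusion\<close>

text \<open>For t = 1, z is a primitive sixth root of unity, so the values 1, 2, 1 recur with
  alternating sign: chi_(j+3) = -chi_j.\<close>

lemma norm_chi_one_le: "norm (chi 1 j) \<le> 2"
proof (induction j rule: less_induct)
  case (less j)
  show ?case
  proof (cases "j < 3")
    case True
    then have "j \<in> {0, 1, 2}" by auto
    then show ?thesis by (auto simp: numeral_2_eq_2)
  next
    case False
    then obtain i where j: "j = Suc (Suc (Suc i))"
      using less_iff_Suc_add[of 2 j] by (auto simp: numeral_2_eq_2)
    then have "chi 1 j = - chi 1 i" by simp
    then show ?thesis using less[of i] j by simp
  qed
qed

lemma triprod_one_eq:
  assumes "norm q < 1"
  shows "triprod 1 q n = qpoch (- (q ^ 3)) (q ^ 3) n / qpoch (- q) q n"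
proof -
  have "1 - q ^ Suc k + (q ^ Suc k)\<^sup>2 = (1 - - (q ^ 3) * (q ^ 3) ^ k) / (1 - - q * q ^ k)" for k
  proof -
    have "1 + q ^ Suc k \<noteq> 0"
      using norm_power_Suc_less_one[OF assms, of k] by (metis add_eq_0_iff less_irrefl norm_minus_cancel norm_one)
    moreover have "(q ^ 3) * (q ^ 3) ^ k = (q ^ Suc k) ^ 3"
      by (simp add: power_mult_distrib power_mult[symmetric] mult.commute)
    moreover have "1 - x + x\<^sup>2 = (1 + x ^ 3) / (1 + x)" if "1 + x \<noteq> 0" for x :: complex
      using that by (simp add: divide_simps) algebra
    ultimately show ?thesis by simp
  qed
  then show ?thesis
    by (simp add: triprod_def qpoch_def prod_dividef del: power_Suc)
qed

theorem theorem3p3: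
  fixes q :: complex
  assumes "norm q < 1"
  shows "(\<lambda>n. q ^ (n * (n + 1)) * qpoch (- (q ^ 3)) (q ^ 3) n
               / (qpoch (- q) q n * qpoch q q (2 * n + 1)))
         sums (qpoch_inf (q ^ 3) (q ^ 3) * qpoch_inf (q ^ 3) (q ^ 18) * qpoch_inf (q ^ 15) (q ^ 18)
               / qpoch_inf q q)"
proof -
  have "norm (q ^ 3) < 1"
    using norm_power_Suc_less_one[OF assms, of 2] by (simp add: numeral_3_eq_3)
  \<comment> \<open>Base q^3 turns the exponents 1, 5, 6 into 3, 15, 18.\<close>
  from triprod_one_tendsto[OF this]
  have "triprod 1 (q ^ 3) \<longlonglongrightarrow> qpoch_inf (q ^ 3) (q ^ 18) * qpoch_inf (q ^ 15) (q ^ 18)"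
    by (simp flip: power_mult)
  from bailey_lemma[OF assms norm_chi_one_le this] show ?thesis
    by (simp add: triprod_one_eq[OF assms] mult.assoc)
qed

end
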